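(* Let $P:\mathbb{R}^n\to\mathbb{R}$ be a norm with dual norm $P_*$, and assume that we have an oracle that computes, for any $y\in\mathbb{R}^n$, the Euclidean projection $\Pi_*(y)=\arg\min\{\|y-x\|^2: P_*(x)\le1\}$ onto the unit ball of the dual norm. Let $x_0\in\mathbb{R}^n$. Then one can find an $\varepsilon$-approximate solution to the problem $$\min_{x\in\mathbb{R}^n:\,P(x)\le1}\|x_0-x\|^2$$ by using $O(\log(1/\varepsilon))$ calls to that oracle (as $\varepsilon\to0$, the hidden constant not depending on $\varepsilon$). That is, there is an algorithm which, given $x_0$ and $\varepsilon$, and accessing the norm only through the oracle $\Pi_*$, outputs such an approximate solution after $O(\log(1/\varepsilon))$ oracle calls.
   Context: $\|\cdot\|$ is the Euclidean norm. The dual norm of $P$ is $P_*(x)=\max_{P(z)\le1}z^\top x$. A point $\bar x\in\mathbb{R}^n$ is an $\varepsilon$-approximate solution if $\|\bar x-x_0\|^2\le\|x-x_0\|^2+\varepsilon$ for every $x$ with $P(x)\le1$, and $P(\bar x)-1\le\varepsilon$. Standing assumptions: the algorithm knows a constant $G$ such that $|P(x)-P(y)|\le G\|x-y\|$ for all $x,y$, and a number $R\ge1$ such that the dual function $d(\lambda)=\min_{x\in\mathbb{R}^n}\{\|x_0-x\|^2+\lambda(P(x)-1)\}$ has a maximizer over $\lambda\ge0$ lying in $[0,R]$. The constant hidden in $O(\log(1/\varepsilon))$ may depend on $R$, $G$ and $x_0$. Besides oracle calls the algorithm performs only exact real arithmetic. The norm $P$ is not assumed to be smooth. *)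

theory Defs
  imports "HOL-Analysis.Analysis" "HOL-Library.Landau_Symbols"
begin

section \<open>Norms, dual norms and the projection problem\<close>

definition is_norm :: "(real ^ 'n \<Rightarrow> real) \<Rightarrow> bool" where
  "is_norm P \<longleftrightarrow>
     (\<forall>x. 0 \<le> P x) \<and>
     (\<forall>x. P x = 0 \<longleftrightarrow> x = 0) \<and>
     (\<forall>c x. P (c *\<^sub>R x) = \<bar>c\<bar> * P x) \<and>
     (\<forall>x y. P (x + y) \<le> P x + P y)"

text \<open>If \<open>P\<close> is a norm, its unit ball is compact and nonempty, so the supremum is a maximum.\<close>

definition dual_norm :: "(real ^ 'n \<Rightarrow> real) \<Rightarrow> real ^ 'n \<Rightarrow> real" where
  "dual_norm P x = (SUP z \<in> {z. P z \<le> 1}. z \<bullet> x)"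

definition dual_projection :: "(real ^ 'n \<Rightarrow> real) \<Rightarrow> real ^ 'n \<Rightarrow> real ^ 'n" where
  "dual_projection P y = (ARG_MIN (\<lambda>x. (norm (y - x))\<^sup>2) x. dual_norm P x \<le> 1)"

text \<open>For a norm \<open>P\<close> and \<open>l \<ge> 0\<close> the infimum is a minimum (the objective is continuous and
  coercive). The function is only used for such \<open>l\<close>.\<close>

definition dual_fun :: "(real ^ 'n \<Rightarrow> real) \<Rightarrow> real ^ 'n \<Rightarrow> real \<Rightarrow> real" where
  "dual_fun P x\<^sub>0 l = (INF x. (norm (x\<^sub>0 - x))\<^sup>2 + l * (P x - 1))"

definition approx_solution ::
    "(real ^ 'n \<Rightarrow> real) \<Rightarrow> real ^ 'n \<Rightarrow> real \<Rightarrow> real ^ 'n \<Rightarrow> bool" where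
  "approx_solution P x\<^sub>0 \<epsilon> x' \<longleftrightarrow>
     (\<forall>x. P x \<le> 1 \<longrightarrow> (norm (x' - x\<^sub>0))\<^sup>2 \<le> (norm (x - x\<^sub>0))\<^sup>2 + \<epsilon>) \<and>
     P x' - 1 \<le> \<epsilon>"


section \<open>Oracle algorithms in exact real arithmetic\<close>

text \<open>
  A program is a piece of finite syntax acting on scalar registers (holding reals) and
  vector registers (holding points of \<open>real ^ 'n\<close>). It can compute the field operations, the
  vector space operations and inner products exactly, branch on and loop over exact comparisons
  of reals, and call the oracle. The syntax mentions neither the dimension nor the norm, and the
  only literals are integers. Coordinates of vectors cannot be accessed individually; since
  programs are only ever claimed to exist, this restriction on the available operations, like
  the omission of roots and other real functions, can only make such a claim stronger.
  Following HOL, division by zero yields zero.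
\<close>

datatype sexp =
    SConst int
  | SReg nat
  | SAdd sexp sexp
  | SSub sexp sexp
  | SMul sexp sexp
  | SDiv sexp sexp
  | SInner vexp vexp
and vexp =
    VReg nat
  | VAdd vexp vexp
  | VSub vexp vexp
  | VScale sexp vexp

datatype bexp =
    BLess sexp sexp
  | BNot bexp
  | BAnd bexp bexp

datatype program =
    Skip
  | SAssign nat sexp
  | VAssign nat vexp
  | Oracle nat vexp \<comment> \<open>call the oracle on the value of an expression, store the answer\<close>
  | Seq program program
  | Cond bexp program program
  | While bexp program

type_synonym 'n state = "(nat \<Rightarrow> real) \<times> (nat \<Rightarrow> real ^ 'n)"

primrec sval :: "'n::finite state \<Rightarrow> sexp \<Rightarrow> real"
    and vval :: "'n::finite state \<Rightarrow> vexp \<Rightarrow> real ^ 'n" where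
  "sval s (SConst k) = of_int k"
| "sval s (SReg i) = fst s i"
| "sval s (SAdd a b) = sval s a + sval s b"
| "sval s (SSub a b) = sval s a - sval s b"
| "sval s (SMul a b) = sval s a * sval s b"
| "sval s (SDiv a b) = sval s a / sval s b"
| "sval s (SInner u v) = vval s u \<bullet> vval s v"
| "vval s (VReg i) = snd s i"
| "vval s (VAdd u v) = vval s u + vval s v"
| "vval s (VSub u v) = vval s u - vval s v"
| "vval s (VScale a u) = sval s a *\<^sub>R vval s u"

primrec bval :: "'n::finite state \<Rightarrow> bexp \<Rightarrow> bool" where
  "bval s (BLess a b) \<longleftrightarrow> sval s a < sval s b"
| "bval s (BNot b) \<longleftrightarrow> \<not> bval s b"
| "bval s (BAnd b c) \<longleftrightarrow> bval s b \<and> bval s c"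

text \<open>
  \<open>exec orc c s k t\<close>: with oracle \<open>orc\<close>, program \<open>c\<close> started in state \<open>s\<close> terminates in state \<open>t\<close>
  after exactly \<open>k\<close> oracle calls. The oracle is the only access to the problem data that is not
  already stored in \<open>s\<close>.
\<close>

inductive exec ::
    "(real ^ 'n \<Rightarrow> real ^ 'n) \<Rightarrow> program \<Rightarrow> 'n::finite state \<Rightarrow> nat \<Rightarrow> 'n state \<Rightarrow> bool"
  for orc where
  Skip: "exec orc Skip s 0 s"
| SAssign: "exec orc (SAssign i a) s 0 ((fst s)(i := sval s a), snd s)"
| VAssign: "exec orc (VAssign i u) s 0 (fst s, (snd s)(i := vval s u))"
| Oracle: "exec orc (Oracle i u) s 1 (fst s, (snd s)(i := orc (vval s u)))"
| Seq: "exec orc c s j t \<Longrightarrow> exec orc d t k u \<Longrightarrow> exec orc (Seq c d) s (j + k) u"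
| CondTrue: "bval s b \<Longrightarrow> exec orc c s k t \<Longrightarrow> exec orc (Cond b c d) s k t"
| CondFalse: "\<not> bval s b \<Longrightarrow> exec orc d s k t \<Longrightarrow> exec orc (Cond b c d) s k t"
| WhileFalse: "\<not> bval s b \<Longrightarrow> exec orc (While b c) s 0 s"
| WhileTrue: "bval s b \<Longrightarrow> exec orc c s j t \<Longrightarrow> exec orc (While b c) t k u \<Longrightarrow>
    exec orc (While b c) s (j + k) u"

inductive_cases exec_SkipE: "exec orc Skip s k t"
inductive_cases exec_SAssignE: "exec orc (SAssign i a) s k t"
inductive_cases exec_VAssignE: "exec orc (VAssign i u) s k t"
inductive_cases exec_OracleE: "exec orc (Oracle i u) s k t"
inductive_cases exec_SeqE: "exec orc (Seq c d) s k t"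
inductive_cases exec_CondE: "exec orc (Cond b c d) s k t"
inductive_cases exec_WhileE: "exec orc (While b c) s k t"

text \<open>
  Programs are deterministic, so the existence of an \<open>exec\<close> derivation says that \<^emph>\<open>the\<close> run
  from the given state terminates with the given result and number of oracle calls.
\<close>

lemma exec_deterministic:
  "exec orc c s k t \<Longrightarrow> exec orc c s k' t' \<Longrightarrow> k' = k \<and> t' = t"
proof (induction arbitrary: k' t' rule: exec.induct)
  case (Seq c s j t d k u)
  from Seq.prems show ?case by (rule exec_SeqE) (use Seq.IH in blast)
next
  case (CondTrue s b c k t d)
  from CondTrue.prems show ?case by (rule exec_CondE) (use CondTrue in blast)+
next
  case (CondFalse s b d k t c)
  from CondFalse.prems show ?case by (rule exec_CondE) (use CondFalse in blast)+
next
  case (WhileFalse s b c)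
  from WhileFalse.prems show ?case by (rule exec_WhileE) (use WhileFalse.hyps in auto)
next
  case (WhileTrue s b c j t k u)
  from WhileTrue.prems show ?case
    by (rule exec_WhileE) (use WhileTrue.hyps WhileTrue.IH in blast)+
qed (auto elim: exec_SkipE exec_SAssignE exec_VAssignE exec_OracleE)

text \<open>The input is stored in the first registers of each kind; all others are initially zero.
  The output is read from vector register 0.\<close>

definition input_state :: "real ^ 'n \<Rightarrow> real \<Rightarrow> real \<Rightarrow> real \<Rightarrow> 'n::finite state" where
  "input_state x\<^sub>0 \<epsilon> G R = ((\<lambda>_. 0)(0 := \<epsilon>, 1 := G, 2 := R), (\<lambda>_. 0)(0 := x\<^sub>0))"

definition output_of :: "'n::finite state \<Rightarrow> real ^ 'n" where
  "output_of s = snd s 0"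

end

theory Submission
  imports Defs "HOL-Real_Asymp.Real_Asymp"
begin

text \<open>
  By Moreau's identity the minimiser of \<open>\<parallel>x - x\<^sub>0\<parallel>\<^sup>2 + 2 \<mu> P x\<close> is \<open>x\<^sub>0 - \<mu> p\<close>, where
  \<open>p\<close> is the projection of \<open>x\<^sub>0 / \<mu>\<close> onto the dual ball, and \<open>p\<close> attains the maximum that
  defines \<open>P\<close> at this point; hence one oracle call yields both the minimiser and the value of
  \<open>P\<close> there. This value is Lipschitz in \<open>\<mu>\<close> with constant \<open>G\<^sup>2\<close>, and it is at most \<open>1\<close> for
  \<open>\<mu> = R\<close>, because otherwise the dual function would be larger at \<open>2 R\<close> than at its maximiser.
  Bisection on \<open>[0, R]\<close> keeps a left end with value at least \<open>1\<close> (or equal to \<open>0\<close>), whose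
  minimiser has a distance to \<open>x\<^sub>0\<close> that is at most optimal, and a right end with value at most
  \<open>1\<close>. Once the interval has length at most \<open>\<epsilon> / G\<^sup>2\<close>, the left end violates the constraint by
  at most \<open>\<epsilon>\<close>.
\<close>

section \<open>The dual ball\<close>

text \<open>Homogeneity removes the supremum: this is the unit ball of the dual norm as an
  intersection of half-spaces, so closedness and convexity are immediate.\<close>

definition dual_ball :: "(real ^ 'n \<Rightarrow> real) \<Rightarrow> (real ^ 'n) set" where
  "dual_ball P = {q. \<forall>z. q \<bullet> z \<le> P z}"

locale lipschitz_norm =
  fixes P :: "real ^ 'n::finite \<Rightarrow> real" and G :: real
  assumes norm_P: "is_norm P"
    and lipschitz_P: "\<bar>P x - P y\<bar> \<le> G * norm (x - y)"
begin

lemma P_nonneg: "0 \<le> P x"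
  and P_eq_0_iff: "P x = 0 \<longleftrightarrow> x = 0"
  and P_scale: "P (c *\<^sub>R x) = \<bar>c\<bar> * P x"
  and P_triangle: "P (x + y) \<le> P x + P y"
  using norm_P by (auto simp: is_norm_def)

lemma P_zero: "P 0 = 0"
  by (simp add: P_eq_0_iff)

lemma continuous_on_P: "continuous_on S P"
proof (rule continuous_on_subset[OF _ subset_UNIV], rule lipschitz_on_continuous_on)
  have "0 \<le> \<bar>P (axis undefined 1) - P 0\<bar>" by simp
  also have "\<dots> \<le> G * norm (axis undefined 1 - 0 :: real ^ 'n)" by (rule lipschitz_P)
  finally have "0 \<le> G" by simp
  then show "G-lipschitz_on UNIV P"
    by (intro lipschitz_onI) (simp_all add: dist_norm lipschitz_P)
qed

text \<open>A positive minimum on the compact unit sphere extends by homogeneity. It bounds the unit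
  ball of \<open>P\<close>, so that the supremum in \<open>dual_norm\<close> is a genuine
  one.\<close>

lemma P_coercive:
  obtains c where "0 < c" "\<And>x. c * norm x \<le> P x"
proof -
  have "compact (sphere 0 1 :: (real ^ 'n) set)" "sphere 0 1 \<noteq> ({} :: (real ^ 'n) set)"
    by auto
  from continuous_attains_inf[OF this continuous_on_P[of "sphere 0 1"]]
  obtain u where u: "norm u = 1" "\<And>y. norm y = 1 \<Longrightarrow> P u \<le> P y" by auto
  have "u \<noteq> 0" using u(1) by auto
  then have "0 < P u" using P_nonneg[of u] P_eq_0_iff[of u] by linarith
  moreover have "P u * norm x \<le> P x" for x
  proof (cases "x = 0")
    case False
    have "P u \<le> P ((1 / norm x) *\<^sub>R x)" using False by (intro u(2)) simp
    then show ?thesis using False by (simp add: P_scale field_simps)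
  qed (simp add: P_zero)
  ultimately show thesis by (intro that)
qed

lemma dual_norm_le_1_iff: "dual_norm P q \<le> 1 \<longleftrightarrow> q \<in> dual_ball P"
proof -
  obtain c where c: "0 < c" "\<And>x. c * norm x \<le> P x" using P_coercive by blast
  have "z \<bullet> q \<le> norm q / c" if "P z \<le> 1" for z
  proof -
    have "c * norm z \<le> 1" using c(2)[of z] that by linarith
    then have "norm z \<le> 1 / c" using c(1) by (simp add: field_simps)
    then have "norm z * norm q \<le> 1 / c * norm q" by (rule mult_right_mono) simp
    then show ?thesis using norm_cauchy_schwarz[of z q] by simp
  qed
  then have "bdd_above ((\<lambda>z. z \<bullet> q) ` {z. P z \<le> 1})" by (auto intro!: bdd_aboveI)
  moreover have "{z. P z \<le> 1} \<noteq> {}" using P_zero by (metis Collect_empty_eq zero_le_one)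
  ultimately have "dual_norm P q \<le> 1 \<longleftrightarrow> (\<forall>z. P z \<le> 1 \<longrightarrow> z \<bullet> q \<le> 1)"
    unfolding dual_norm_def by (subst cSUP_le_iff) auto
  also have "\<dots> \<longleftrightarrow> (\<forall>z. q \<bullet> z \<le> P z)"
  proof safe
    fix z assume *: "\<forall>z. P z \<le> 1 \<longrightarrow> z \<bullet> q \<le> 1"
    show "q \<bullet> z \<le> P z"
    proof (cases "z = 0")
      case False
      then have "0 < P z" using P_nonneg[of z] P_eq_0_iff[of z] by linarith
      then show ?thesis using *[rule_format, of "(1 / P z) *\<^sub>R z"]
        by (simp add: P_scale field_simps inner_commute)
    qed (simp add: P_zero)
  next
    fix z assume "\<forall>z. q \<bullet> z \<le> P z" "P z \<le> 1"
    then show "z \<bullet> q \<le> 1" by (metis inner_commute order_trans)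
  qed
  finally show ?thesis by (simp add: dual_ball_def)
qed

lemma closed_dual_ball: "closed (dual_ball P)"
proof -
  have "dual_ball P = (\<Inter>z. {q. z \<bullet> q \<le> P z})"
    by (auto simp: dual_ball_def inner_commute)
  then show ?thesis by (auto intro!: closed_INT closed_halfspace_le)
qed

lemma convex_dual_ball: "convex (dual_ball P)"
proof -
  have "dual_ball P = (\<Inter>z. {q. z \<bullet> q \<le> P z})"
    by (auto simp: dual_ball_def inner_commute)
  then show ?thesis by (auto intro!: convex_INT convex_halfspace_le)
qed

lemma zero_in_dual_ball: "0 \<in> dual_ball P"
  by (simp add: dual_ball_def P_nonneg)

text \<open>Testing \<open>q\<close> against itself bounds its squared length by \<open>P q\<close>,
  hence by \<open>G * norm q\<close>.\<close>

lemma norm_dual_ball_le: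
  assumes "q \<in> dual_ball P"
  shows "norm q \<le> G"
proof (cases "q = 0")
  case True
  then show ?thesis
    using lipschitz_P[of "axis undefined 1" 0] by simp
next
  case False
  have "norm q * norm q = q \<bullet> q" by (simp add: power2_norm_eq_inner flip: power2_eq_square)
  also have "\<dots> \<le> P q" using assms by (simp add: dual_ball_def)
  also have "\<dots> \<le> G * norm q" using lipschitz_P[of q 0] by (simp add: P_zero)
  finally show ?thesis using False by simp
qed

lemma dual_projection:
  shows "dual_projection P y \<in> dual_ball P" (is "?p \<in> _")
    and "q \<in> dual_ball P \<Longrightarrow> (y - dual_projection P y) \<bullet> (q - dual_projection P y) \<le> 0"
proof -
  have "dual_ball P \<noteq> {}" using zero_in_dual_ball by blast
  note cp = closest_point_exists[OF closed_dual_ball this, of y]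
  let ?f = "\<lambda>x. (norm (y - x))\<^sup>2"
  have "is_arg_min ?f (\<lambda>x. dual_norm P x \<le> 1) (closest_point (dual_ball P) y)"
    using cp by (auto simp: is_arg_min_linorder dual_norm_le_1_iff dist_norm)
  \<comment> \<open>The oracle is defined by choice; the closest point witnesses that there is a
    minimiser to choose.\<close>
  then have "is_arg_min ?f (\<lambda>x. dual_norm P x \<le> 1) ?p"
    unfolding dual_projection_def arg_min_def by (rule someI)
  then have p: "?p \<in> dual_ball P" and min: "\<And>q. q \<in> dual_ball P \<Longrightarrow> ?f ?p \<le> ?f q"
    by (auto simp: is_arg_min_linorder dual_norm_le_1_iff)
  show "?p \<in> dual_ball P" by (rule p)
  show "(y - ?p) \<bullet> (q - ?p) \<le> 0" if "q \<in> dual_ball P"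
    using min by (intro any_closest_point_dot[OF convex_dual_ball closed_dual_ball p that])
      (auto simp: dist_norm intro: power2_le_imp_le)
qed

text \<open>The bidual norm is \<open>P\<close>, by separating the unit ball from points outside it.\<close>

lemma P_eq_inner_if_maximal:
  assumes "p \<in> dual_ball P" and max: "\<And>q. q \<in> dual_ball P \<Longrightarrow> q \<bullet> v \<le> p \<bullet> v"
  shows "P v = p \<bullet> v"
proof (rule antisym)
  show "p \<bullet> v \<le> P v" using assms(1) by (simp add: dual_ball_def)
  show "P v \<le> p \<bullet> v"
  proof (rule ccontr)
    assume "\<not> P v \<le> p \<bullet> v"
    \<comment> \<open>The value \<open>p \<bullet> v\<close> may be zero; an intermediate
      \<open>s\<close> is positive and can be divided by.\<close>
    then obtain s where s: "p \<bullet> v < s" "s < P v" using dense by (metis not_le)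
    have "0 \<le> p \<bullet> v" using max[OF zero_in_dual_ball] by simp
    then have "0 < s" using s by simp
    let ?B = "{z. P z \<le> 1}"
    have "convex ?B"
    proof (rule convexI)
      fix x y and a b :: real
      assume *: "x \<in> ?B" "y \<in> ?B" "0 \<le> a" "0 \<le> b" "a + b = 1"
      have "P (a *\<^sub>R x + b *\<^sub>R y) \<le> a * P x + b * P y"
        using P_triangle[of "a *\<^sub>R x" "b *\<^sub>R y"] * by (simp add: P_scale)
      also have "\<dots> \<le> a * 1 + b * 1" using * by (intro add_mono mult_left_mono) auto
      finally show "a *\<^sub>R x + b *\<^sub>R y \<in> ?B" using * by simp
    qed
    moreover have "closed ?B"
      by (intro closed_Collect_le continuous_on_P continuous_on_const)
    moreover have "(1 / s) *\<^sub>R v \<notin> ?B"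
      using s \<open>0 < s\<close> by (simp add: P_scale field_simps)
    ultimately have "\<exists>a b. a \<bullet> ((1 / s) *\<^sub>R v) < b \<and> (\<forall>x \<in> ?B. b < a \<bullet> x)"
      by (rule separating_hyperplane_closed_point)
    then obtain a b where ab: "a \<bullet> ((1 / s) *\<^sub>R v) < b" "\<And>x. x \<in> ?B \<Longrightarrow> b < a \<bullet> x"
      by auto
    have "b < 0" using ab(2)[of 0] by (simp add: P_zero)
    \<comment> \<open>Dividing by the negative \<open>b\<close> reverses both separation
      inequalities: \<open>?q\<close> lies in the dual ball, yet its product with \<open>v\<close>
      exceeds \<open>s\<close>.\<close>
    let ?q = "(1 / b) *\<^sub>R a"
    have "z \<bullet> ?q \<le> 1" if "P z \<le> 1" for z
      using ab(2)[of z] that \<open>b < 0\<close> by (simp add: field_simps inner_commute)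
    then have "dual_norm P ?q \<le> 1"
      unfolding dual_norm_def
      by (intro cSUP_least) (use P_zero in \<open>auto intro: exI[of _ 0]\<close>)
    then have "?q \<bullet> v \<le> p \<bullet> v" by (intro max) (simp add: dual_norm_le_1_iff)
    moreover have "s < ?q \<bullet> v" using ab(1) \<open>b < 0\<close> \<open>0 < s\<close> by (simp add: field_simps)
    ultimately show False using s by simp
  qed
qed

end

section \<open>The proximal map\<close>

text \<open>With \<open>1 / 0 = 0\<close>, the value at \<open>\<mu> = 0\<close> is \<open>x\<^sub>0\<close>.\<close>

definition prox :: "(real ^ 'n \<Rightarrow> real) \<Rightarrow> real ^ 'n \<Rightarrow> real \<Rightarrow> real ^ 'n" where
  "prox P x\<^sub>0 \<mu> = x\<^sub>0 - \<mu> *\<^sub>R dual_projection P ((1 / \<mu>) *\<^sub>R x\<^sub>0)"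

context lipschitz_norm
begin

text \<open>Scaled by \<mu>, the variational inequality of the projection says that the oracle's
  answer maximises the inner product with the proximal point over the dual ball.\<close>

lemma P_prox:
  assumes "0 < \<mu>"
  shows "P (prox P x\<^sub>0 \<mu>) = dual_projection P ((1 / \<mu>) *\<^sub>R x\<^sub>0) \<bullet> prox P x\<^sub>0 \<mu>"
proof (rule P_eq_inner_if_maximal)
  let ?p = "dual_projection P ((1 / \<mu>) *\<^sub>R x\<^sub>0)"
  show "?p \<in> dual_ball P" by (rule dual_projection)
  fix q assume "q \<in> dual_ball P"
  then have "((1 / \<mu>) *\<^sub>R x\<^sub>0 - ?p) \<bullet> (q - ?p) \<le> 0" by (rule dual_projection)
  moreover have "prox P x\<^sub>0 \<mu> = \<mu> *\<^sub>R ((1 / \<mu>) *\<^sub>R x\<^sub>0 - ?p)"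
    using assms by (simp add: prox_def algebra_simps)
  ultimately have "prox P x\<^sub>0 \<mu> \<bullet> (q - ?p) \<le> 0"
    using assms by (simp add: mult_le_0_iff)
  then show "q \<bullet> prox P x\<^sub>0 \<mu> \<le> ?p \<bullet> prox P x\<^sub>0 \<mu>"
    by (simp add: inner_diff_right inner_commute)
qed

text \<open>For positive \<mu>, let \<open>y\<close> be the proximal point and \<open>p\<close> the
  oracle's answer. Expanding the square around \<open>y\<close> shows that the sides differ by
  \<open>(norm (x - y))\<^sup>2 + 2 * \<mu> * (P x - p \<bullet> x)\<close>.\<close>

lemma prox_minimises:
  assumes "0 \<le> \<mu>"
  shows "(norm (prox P x\<^sub>0 \<mu> - x\<^sub>0))\<^sup>2 + 2 * \<mu> * P (prox P x\<^sub>0 \<mu>)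
    \<le> (norm (x - x\<^sub>0))\<^sup>2 + 2 * \<mu> * P x"
proof (cases "\<mu> = 0")
  case False
  define p where "p = dual_projection P ((1 / \<mu>) *\<^sub>R x\<^sub>0)"
  define y where "y = prox P x\<^sub>0 \<mu>"
  have y: "y - x\<^sub>0 = - (\<mu> *\<^sub>R p)" by (simp add: y_def prox_def p_def)
  have Py: "P y = p \<bullet> y" using P_prox[of \<mu> x\<^sub>0] assms False by (simp add: y_def p_def)
  have Px: "p \<bullet> x \<le> P x" using dual_projection(1) by (simp add: p_def dual_ball_def)
  have square: "(norm (u + v))\<^sup>2 = (norm u)\<^sup>2 + (norm v)\<^sup>2 + 2 * (u \<bullet> v)" for u v :: "real ^ 'n"
    by (simp add: power2_norm_eq_inner inner_add inner_commute)
  have "(norm (x - x\<^sub>0))\<^sup>2 = (norm ((x - y) + (y - x\<^sub>0)))\<^sup>2" by simp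
  also have "\<dots> = (norm (x - y))\<^sup>2 + (norm (y - x\<^sub>0))\<^sup>2 + 2 * ((x - y) \<bullet> (y - x\<^sub>0))"
    by (rule square)
  also have "(x - y) \<bullet> (y - x\<^sub>0) = - (\<mu> * (p \<bullet> (x - y)))"
    by (simp add: y inner_commute)
  finally have "(norm (x - x\<^sub>0))\<^sup>2 + 2 * \<mu> * (p \<bullet> x) =
      (norm (x - y))\<^sup>2 + (norm (y - x\<^sub>0))\<^sup>2 + 2 * \<mu> * (p \<bullet> y)"
    by (simp add: inner_diff algebra_simps)
  moreover have "2 * \<mu> * (p \<bullet> x) \<le> 2 * \<mu> * P x" using Px assms by (intro mult_left_mono) auto
  ultimately show ?thesis
    unfolding y_def[symmetric] Py using zero_le_power2[of "norm (x - y)"] by linarith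
qed (simp add: prox_def)

lemma norm_prox_diff_le:
  assumes "0 \<le> \<mu>" "\<mu> < \<nu>"
  shows "norm (prox P x\<^sub>0 \<mu> - prox P x\<^sub>0 \<nu>) \<le> G * (\<nu> - \<mu>)"
proof (cases "\<mu> = 0")
  case True
  have "norm (dual_projection P ((1 / \<nu>) *\<^sub>R x\<^sub>0)) \<le> G"
    by (intro norm_dual_ball_le dual_projection)
  then show ?thesis using True assms by (simp add: prox_def mult.commute mult_left_mono)
next
  case False
  define p where "p = dual_projection P ((1 / \<mu>) *\<^sub>R x\<^sub>0)"
  define q where "q = dual_projection P ((1 / \<nu>) *\<^sub>R x\<^sub>0)"
  define x where "x = prox P x\<^sub>0 \<mu>"
  define y where "y = prox P x\<^sub>0 \<nu>"
  have pq: "p \<in> dual_ball P" "q \<in> dual_ball P"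
    unfolding p_def q_def by (rule dual_projection)+
  have "p \<bullet> x = P x" "q \<bullet> y = P y"
    using P_prox[of \<mu> x\<^sub>0] P_prox[of \<nu> x\<^sub>0] assms False by (simp_all add: p_def q_def x_def y_def)
  moreover have "q \<bullet> x \<le> P x" "p \<bullet> y \<le> P y" using pq by (auto simp: dual_ball_def)
  \<comment> \<open>Monotonicity of the subdifferential: \<open>p\<close> and \<open>q\<close> are
    subgradients of \<open>P\<close> at \<open>x\<close> and \<open>y\<close>.\<close>
  ultimately have mono: "0 \<le> (p - q) \<bullet> (x - y)" by (simp add: inner_diff)
  have "x - y = (\<nu> - \<mu>) *\<^sub>R q - \<mu> *\<^sub>R (p - q)"
    by (simp add: x_def y_def prox_def p_def q_def algebra_simps)
  then have "(x - y) \<bullet> (x - y) = ((\<nu> - \<mu>) *\<^sub>R q - \<mu> *\<^sub>R (p - q)) \<bullet> (x - y)" by simp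
  also have "\<dots> = (\<nu> - \<mu>) * (q \<bullet> (x - y)) - \<mu> * ((p - q) \<bullet> (x - y))"
    by (simp add: inner_diff_left)
  also have "\<dots> \<le> (\<nu> - \<mu>) * (q \<bullet> (x - y))" using mono assms by simp
  also have "\<dots> \<le> (\<nu> - \<mu>) * (G * norm (x - y))"
  proof (rule mult_left_mono)
    have "q \<bullet> (x - y) \<le> norm q * norm (x - y)" by (rule norm_cauchy_schwarz)
    also have "\<dots> \<le> G * norm (x - y)"
      by (intro mult_right_mono norm_dual_ball_le pq) simp
    finally show "q \<bullet> (x - y) \<le> G * norm (x - y)" .
  qed (use assms in simp)
  finally have *: "norm (x - y) * norm (x - y) \<le> (G * (\<nu> - \<mu>)) * norm (x - y)"
    by (simp add: power2_norm_eq_inner mult_ac flip: power2_eq_square)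
  \<comment> \<open>This settles the case \<open>x = y\<close>, where the norm cannot be
    cancelled.\<close>
  have "0 \<le> G * (\<nu> - \<mu>)"
    using norm_dual_ball_le[OF zero_in_dual_ball] assms by simp
  with * show ?thesis
    unfolding x_def[symmetric] y_def[symmetric] by (cases "x = y") auto
qed

text \<open>One factor \<open>G\<close> comes from \<open>P\<close>, the other from the speed of the
  proximal path.\<close>

lemma P_prox_le:
  assumes "0 \<le> \<mu>" "\<mu> < \<nu>" "P (prox P x\<^sub>0 \<nu>) \<le> 1"
  shows "P (prox P x\<^sub>0 \<mu>) - 1 \<le> G\<^sup>2 * (\<nu> - \<mu>)"
proof -
  have "0 \<le> G" using norm_dual_ball_le[OF zero_in_dual_ball] by simp
  have "P (prox P x\<^sub>0 \<mu>) - P (prox P x\<^sub>0 \<nu>) \<le> G * norm (prox P x\<^sub>0 \<mu> - prox P x\<^sub>0 \<nu>)"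
    using lipschitz_P[of "prox P x\<^sub>0 \<mu>" "prox P x\<^sub>0 \<nu>"] by linarith
  also have "\<dots> \<le> G * (G * (\<nu> - \<mu>))"
    by (intro mult_left_mono norm_prox_diff_le assms \<open>0 \<le> G\<close>)
  finally show ?thesis using assms(3) by (simp add: power2_eq_square)
qed

text \<open>Only the constraint uses the slack: when \<open>P x\<close> is at most the value at the
  proximal point, minimality already compares the distances. At \<open>\<mu> = 0\<close> the penalty
  vanishes.\<close>

lemma approx_solution_prox:
  assumes "0 \<le> \<mu>" "\<mu> = 0 \<or> 1 \<le> P (prox P x\<^sub>0 \<mu>)" "\<mu> < \<nu>" "P (prox P x\<^sub>0 \<nu>) \<le> 1"
    and "G\<^sup>2 * (\<nu> - \<mu>) \<le> \<epsilon>" "0 < \<epsilon>"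
  shows "approx_solution P x\<^sub>0 \<epsilon> (prox P x\<^sub>0 \<mu>)"
  unfolding approx_solution_def
proof (intro conjI allI impI)
  show "P (prox P x\<^sub>0 \<mu>) - 1 \<le> \<epsilon>" using P_prox_le[OF assms(1,3,4)] assms(5) by linarith
  fix x assume "P x \<le> 1"
  have "\<mu> * P x \<le> \<mu> * P (prox P x\<^sub>0 \<mu>)"
  proof (cases "\<mu> = 0")
    case False
    then show ?thesis using assms(1,2) \<open>P x \<le> 1\<close> by (intro mult_left_mono) auto
  qed simp
  then show "(norm (prox P x\<^sub>0 \<mu> - x\<^sub>0))\<^sup>2 \<le> (norm (x - x\<^sub>0))\<^sup>2 + \<epsilon>"
    using prox_minimises[OF assms(1), of x\<^sub>0 x] assms(6) by linarith
qed

section \<open>The multiplier bound from the dual function\<close>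

lemma dual_fun_le:
  assumes "0 \<le> l"
  shows "dual_fun P x\<^sub>0 l \<le> (norm (x\<^sub>0 - x))\<^sup>2 + l * (P x - 1)"
  unfolding dual_fun_def
proof (rule cINF_lower)
  have "- l \<le> (norm (x\<^sub>0 - x))\<^sup>2 + l * (P x - 1)" for x
    using assms P_nonneg[of x] mult_nonneg_nonneg[of l "P x"] zero_le_power2[of "norm (x\<^sub>0 - x)"]
    by (simp add: algebra_simps)
  then show "bdd_below (range (\<lambda>x. (norm (x\<^sub>0 - x))\<^sup>2 + l * (P x - 1)))"
    by (auto intro!: bdd_belowI)
qed simp

lemma P_prox_le_1:
  assumes "is_arg_max (dual_fun P x\<^sub>0) (\<lambda>m. m \<ge> 0) l" "l < 2 * \<mu>"
  shows "P (prox P x\<^sub>0 \<mu>) \<le> 1"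
proof (rule ccontr)
  let ?y = "prox P x\<^sub>0 \<mu>"
  assume "\<not> P ?y \<le> 1"
  have l: "0 \<le> l" and max: "\<And>m. 0 \<le> m \<Longrightarrow> dual_fun P x\<^sub>0 m \<le> dual_fun P x\<^sub>0 l"
    using assms(1) by (auto simp: is_arg_max_linorder)
  have "dual_fun P x\<^sub>0 l \<le> (norm (x\<^sub>0 - ?y))\<^sup>2 + l * (P ?y - 1)" using l by (rule dual_fun_le)
  \<comment> \<open>At a fixed point the Lagrangian is affine in the multiplier, here with positive
    slope \<open>P ?y - 1\<close>.\<close>
  also have "\<dots> < (norm (x\<^sub>0 - ?y))\<^sup>2 + 2 * \<mu> * (P ?y - 1)"
    using \<open>\<not> P ?y \<le> 1\<close> assms(2) by simp
  \<comment> \<open>The proximal point for \<mu> minimises the Lagrangian with multiplier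
    \<open>2 * \<mu>\<close>.\<close>
  also have "\<dots> \<le> dual_fun P x\<^sub>0 (2 * \<mu>)"
    unfolding dual_fun_def
  proof (rule cINF_greatest)
    fix x
    show "(norm (x\<^sub>0 - ?y))\<^sup>2 + 2 * \<mu> * (P ?y - 1) \<le> (norm (x\<^sub>0 - x))\<^sup>2 + 2 * \<mu> * (P x - 1)"
      using prox_minimises[of \<mu> x\<^sub>0 x] l assms(2) by (simp add: norm_minus_commute algebra_simps)
  qed simp
  also have "\<dots> \<le> dual_fun P x\<^sub>0 l" using l assms(2) by (intro max) simp
  finally show False by simp
qed

end

section \<open>The bisection program\<close>

text \<open>Scalar registers: 0 holds \<open>\<epsilon>\<close>, 1 holds \<open>G\<close>, 2 and 3 the right and left end of the interval,
  4 its midpoint. Vector registers: 0 holds the proximal point of the left end, 1 holds \<open>x\<^sub>0\<close>,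
  2 the last answer of the oracle, 3 the proximal point of the midpoint.\<close>

definition bisect_guard :: bexp where
  "bisect_guard =
     BLess (SReg 0) (SMul (SMul (SReg 1) (SReg 1)) (SSub (SReg 2) (SReg 3)))"

text \<open>No instruction evaluates \<open>P\<close>; the test uses the inner product of the
  oracle's answer with the proximal point instead, which is correct by
  \<open>P_prox\<close>.\<close>

definition bisect_step :: program where
  "bisect_step =
     Seq (SAssign 4 (SDiv (SAdd (SReg 3) (SReg 2)) (SConst 2)))
    (Seq (Oracle 2 (VScale (SDiv (SConst 1) (SReg 4)) (VReg 1)))
    (Seq (VAssign 3 (VSub (VReg 1) (VScale (SReg 4) (VReg 2))))
         (Cond (BLess (SConst 1) (SInner (VReg 2) (VReg 3)))
               (Seq (SAssign 3 (SReg 4)) (VAssign 0 (VReg 3)))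
               (SAssign 2 (SReg 4)))))"

definition bisect_program :: program where
  "bisect_program = Seq (VAssign 1 (VReg 0)) (While bisect_guard bisect_step)"

lemma exec_cond:
  assumes "bval s b \<Longrightarrow> exec orc c s k t" "\<not> bval s b \<Longrightarrow> exec orc d s k t"
  shows "exec orc (Cond b c d) s k t"
  using assms by (cases "bval s b") (auto intro: exec.intros)

section \<open>Correctness and call count of the bisection\<close>

context lipschitz_norm
begin

definition bisect_inv :: "real ^ 'n \<Rightarrow> real \<Rightarrow> real \<Rightarrow> 'n state \<Rightarrow> bool" where
  "bisect_inv x\<^sub>0 \<epsilon> w s \<longleftrightarrow> fst s 0 = \<epsilon> \<and> fst s 1 = G \<and> fst s 2 - fst s 3 = w \<and> 0 \<le> fst s 3 \<and>
     P (prox P x\<^sub>0 (fst s 2)) \<le> 1 \<and> (fst s 3 = 0 \<or> 1 \<le> P (prox P x\<^sub>0 (fst s 3))) \<and>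
     snd s 0 = prox P x\<^sub>0 (fst s 3) \<and> snd s 1 = x\<^sub>0"

lemma exec_bisect_step:
  assumes "bisect_inv x\<^sub>0 \<epsilon> w s" "0 < w"
  obtains t where "exec (dual_projection P) bisect_step s 1 t" "bisect_inv x\<^sub>0 \<epsilon> (w / 2) t"
proof -
  define m where "m = (fst s 3 + fst s 2) / 2"
  define p where "p = dual_projection P ((1 / m) *\<^sub>R x\<^sub>0)"
  have w: "fst s 2 = fst s 3 + w" and lo: "0 \<le> fst s 3"
    using assms(1) by (auto simp: bisect_inv_def)
  have m: "m = fst s 3 + w / 2" by (simp add: m_def w field_simps)
  have "0 < m" using lo assms(2) by (simp add: m)
  then have Pm: "P (prox P x\<^sub>0 m) = p \<bullet> prox P x\<^sub>0 m" unfolding p_def by (rule P_prox)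
  define s1 where "s1 = ((fst s)(4 := m), snd s)"
  define s2 where "s2 = (fst s1, (snd s1)(2 := p))"
  define s3 where "s3 = (fst s2, (snd s2)(3 := prox P x\<^sub>0 m))"
  define t where "t = (if 1 < P (prox P x\<^sub>0 m)
    then ((fst s3)(3 := m), (snd s3)(0 := prox P x\<^sub>0 m)) else ((fst s3)(2 := m), snd s3))"
  have x0: "snd s 1 = x\<^sub>0" using assms(1) by (simp add: bisect_inv_def)
  have "exec (dual_projection P) (SAssign 4 (SDiv (SAdd (SReg 3) (SReg 2)) (SConst 2))) s 0 s1"
    using exec.SAssign[of _ 4 "SDiv (SAdd (SReg 3) (SReg 2)) (SConst 2)" s]
    by (simp add: s1_def m_def)
  moreover have "exec (dual_projection P)
      (Oracle 2 (VScale (SDiv (SConst 1) (SReg 4)) (VReg 1))) s1 1 s2"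
    using exec.Oracle[of "dual_projection P" 2 "VScale (SDiv (SConst 1) (SReg 4)) (VReg 1)" s1] x0
    by (simp add: s2_def s1_def p_def)
  moreover have "exec (dual_projection P)
      (VAssign 3 (VSub (VReg 1) (VScale (SReg 4) (VReg 2)))) s2 0 s3"
    using exec.VAssign[of _ 3 "VSub (VReg 1) (VScale (SReg 4) (VReg 2))" s2] x0
    by (simp add: s3_def s2_def s1_def p_def prox_def)
  moreover have "exec (dual_projection P) (Cond (BLess (SConst 1) (SInner (VReg 2) (VReg 3)))
      (Seq (SAssign 3 (SReg 4)) (VAssign 0 (VReg 3))) (SAssign 2 (SReg 4))) s3 0 t"
  proof (rule exec_cond)
    have b: "bval s3 (BLess (SConst 1) (SInner (VReg 2) (VReg 3))) \<longleftrightarrow> 1 < P (prox P x\<^sub>0 m)"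
      by (simp add: s3_def s2_def Pm)
    {
      assume "bval s3 (BLess (SConst 1) (SInner (VReg 2) (VReg 3)))"
      then show "exec (dual_projection P) (Seq (SAssign 3 (SReg 4)) (VAssign 0 (VReg 3))) s3 0 t"
        using exec.Seq[OF exec.SAssign[of _ 3 "SReg 4" s3] exec.VAssign[of _ 0 "VReg 3"]]
        unfolding b by (simp add: t_def s3_def s2_def s1_def)
    next
      assume "\<not> bval s3 (BLess (SConst 1) (SInner (VReg 2) (VReg 3)))"
      then show "exec (dual_projection P) (SAssign 2 (SReg 4)) s3 0 t"
        using exec.SAssign[of _ 2 "SReg 4" s3]
        unfolding b by (simp add: t_def s3_def s2_def s1_def)
    }
  qed
  ultimately have "exec (dual_projection P) bisect_step s (0 + (1 + (0 + 0))) t"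
    unfolding bisect_step_def by (intro exec.Seq)
  moreover have "bisect_inv x\<^sub>0 \<epsilon> (w / 2) t"
    using assms(1) \<open>0 < m\<close>
    by (auto simp: bisect_inv_def t_def s3_def s2_def s1_def w m field_simps)
  ultimately show thesis by (intro that) simp_all
qed

text \<open>Each iteration costs one call and halves \<open>w\<close>, which pays for one factor of
  two in the bound. At \<open>n = 0\<close> the strict guard fails at once.\<close>

lemma exec_bisect_loop:
  assumes "bisect_inv x\<^sub>0 \<epsilon> w s" "0 < w" "G\<^sup>2 * w \<le> \<epsilon> * 2 ^ n" "0 < \<epsilon>"
  shows "\<exists>k t. exec (dual_projection P) (While bisect_guard bisect_step) s k t \<and>
    k \<le> n \<and> approx_solution P x\<^sub>0 \<epsilon> (output_of t)"
  using assms(1-3)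
proof (induction n arbitrary: s w)
  have guard: "bval s bisect_guard \<longleftrightarrow> \<epsilon> < G\<^sup>2 * w" if "bisect_inv x\<^sub>0 \<epsilon> w s" for w s
    using that by (simp add: bisect_guard_def bisect_inv_def power2_eq_square)
  have stop: "\<exists>k t. exec (dual_projection P) (While bisect_guard bisect_step) s k t \<and>
      k \<le> n \<and> approx_solution P x\<^sub>0 \<epsilon> (output_of t)"
    if inv: "bisect_inv x\<^sub>0 \<epsilon> w s" and "0 < w" "G\<^sup>2 * w \<le> \<epsilon>" for s w n
  proof (intro exI conjI)
    show "exec (dual_projection P) (While bisect_guard bisect_step) s 0 s"
      using that by (intro exec.WhileFalse) (simp add: guard)
    show "approx_solution P x\<^sub>0 \<epsilon> (output_of s)"
      using that approx_solution_prox[of "fst s 3" x\<^sub>0 "fst s 2" \<epsilon>] \<open>0 < \<epsilon>\<close>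
      by (auto simp: bisect_inv_def output_of_def)
  qed simp
  {
    case (0 s w)
    then show ?case by (intro stop) simp_all
  next
    case (Suc n s w)
    show ?case
    proof (cases "G\<^sup>2 * w \<le> \<epsilon>")
      case True
      with Suc.prems show ?thesis by (intro stop)
    next
      case False
      obtain s' where s': "exec (dual_projection P) bisect_step s 1 s'"
        "bisect_inv x\<^sub>0 \<epsilon> (w / 2) s'"
        using Suc.prems by (blast intro: exec_bisect_step)
      from Suc.prems have "0 < w / 2" "G\<^sup>2 * (w / 2) \<le> \<epsilon> * 2 ^ n" by simp_all
      from Suc.IH[OF s'(2) this] obtain k t where
        t: "exec (dual_projection P) (While bisect_guard bisect_step) s' k t" "k \<le> n"
        "approx_solution P x\<^sub>0 \<epsilon> (output_of t)"
        by blast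
      have "bval s bisect_guard" using False Suc.prems by (simp add: guard)
      from exec.WhileTrue[OF this s'(1) t(1)] t(2,3) show ?thesis
        by (intro exI[of _ "1 + k"] exI[of _ t]) simp
    qed
  }
qed

end

theorem theorem3p1:
  shows "\<exists>A :: program. \<forall>(x\<^sub>0 :: real ^ 'n::finite) (G :: real) (R :: real). R \<ge> 1 \<longrightarrow>
    (\<exists>N :: real \<Rightarrow> nat.
      (\<lambda>\<epsilon>. real (N \<epsilon>)) \<in> O[at_right 0](\<lambda>\<epsilon>. ln (1 / \<epsilon>)) \<and>
      (\<forall>P :: real ^ 'n \<Rightarrow> real.
        is_norm P \<longrightarrow>
        (\<forall>x y. \<bar>P x - P y\<bar> \<le> G * norm (x - y)) \<longrightarrow>
        (\<exists>l \<in> {0..R}. is_arg_max (dual_fun P x\<^sub>0) (\<lambda>m. m \<ge> 0) l) \<longrightarrow>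
        (\<forall>\<epsilon> > 0. \<exists>k s. exec (dual_projection P) A (input_state x\<^sub>0 \<epsilon> G R) k s \<and>
          k \<le> N \<epsilon> \<and> approx_solution P x\<^sub>0 \<epsilon> (output_of s))))"
proof (intro exI[of _ bisect_program] allI impI)
  fix x\<^sub>0 :: "real ^ 'n" and G R :: real
  assume "1 \<le> R"
  \<comment> \<open>The summand 1 keeps \<open>C\<close> positive for every \<open>G\<close>, so its
    logarithm is meaningful; neither \<open>C\<close> nor \<open>N\<close> depends on the
    norm.\<close>
  define C where "C = (G\<^sup>2 + 1) * R"
  have "0 < C" using \<open>1 \<le> R\<close> by (simp add: C_def add_nonneg_pos)
  define N where "N = (\<lambda>\<epsilon>. nat \<lceil>log 2 (C / \<epsilon>)\<rceil>)"
  show "\<exists>N :: real \<Rightarrow> nat.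
      (\<lambda>\<epsilon>. real (N \<epsilon>)) \<in> O[at_right 0](\<lambda>\<epsilon>. ln (1 / \<epsilon>)) \<and>
      (\<forall>P :: real ^ 'n \<Rightarrow> real.
        is_norm P \<longrightarrow>
        (\<forall>x y. \<bar>P x - P y\<bar> \<le> G * norm (x - y)) \<longrightarrow>
        (\<exists>l \<in> {0..R}. is_arg_max (dual_fun P x\<^sub>0) (\<lambda>m. m \<ge> 0) l) \<longrightarrow>
        (\<forall>\<epsilon> > 0. \<exists>k s. exec (dual_projection P) bisect_program (input_state x\<^sub>0 \<epsilon> G R) k s \<and>
          k \<le> N \<epsilon> \<and> approx_solution P x\<^sub>0 \<epsilon> (output_of s)))"
  proof (intro exI[of _ N] conjI allI impI)
    \<comment> \<open>Rounding up costs at most 1, and the absolute value covers the truncation by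
      \<open>nat\<close>.\<close>
    have "(\<lambda>\<epsilon>. real (N \<epsilon>)) \<in> O[at_right 0](\<lambda>\<epsilon>. \<bar>log 2 (C / \<epsilon>)\<bar> + 1)"
      by (intro bigoI[of _ 1] always_eventually) (auto simp: N_def, linarith)
    also have "(\<lambda>\<epsilon>. \<bar>log 2 (C / \<epsilon>)\<bar> + 1) \<in> O[at_right 0](\<lambda>\<epsilon>. ln (1 / \<epsilon>))"
      using \<open>0 < C\<close> unfolding log_def by real_asymp
    finally show "(\<lambda>\<epsilon>. real (N \<epsilon>)) \<in> O[at_right 0](\<lambda>\<epsilon>. ln (1 / \<epsilon>))" .
  next
    fix P :: "real ^ 'n \<Rightarrow> real" and \<epsilon> :: real
    assume "is_norm P" "\<forall>x y. \<bar>P x - P y\<bar> \<le> G * norm (x - y)"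
    then interpret lipschitz_norm P G by unfold_locales auto
    assume "\<exists>l \<in> {0..R}. is_arg_max (dual_fun P x\<^sub>0) (\<lambda>m. m \<ge> 0) l" and "0 < \<epsilon>"
    \<comment> \<open>The maximiser is at most \<open>R\<close>, hence strictly below
      \<open>2 * R\<close>.\<close>
    then have "P (prox P x\<^sub>0 R) \<le> 1" using \<open>1 \<le> R\<close> by (auto intro!: P_prox_le_1)
    define s where
      "s = (fst (input_state x\<^sub>0 \<epsilon> G R), (snd (input_state x\<^sub>0 \<epsilon> G R))(1 := x\<^sub>0))"
    have init: "exec (dual_projection P) (VAssign 1 (VReg 0)) (input_state x\<^sub>0 \<epsilon> G R) 0 s"
      using exec.VAssign[of _ 1 "VReg 0" "input_state x\<^sub>0 \<epsilon> G R"]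
      by (simp add: s_def input_state_def)
    \<comment> \<open>The left end is zero initially, and its proximal point is
      \<open>x\<^sub>0\<close>, already in vector register 0.\<close>
    have inv: "bisect_inv x\<^sub>0 \<epsilon> R s"
      using \<open>P (prox P x\<^sub>0 R) \<le> 1\<close> by (simp add: bisect_inv_def s_def input_state_def prox_def)
    have "log 2 (C / \<epsilon>) \<le> real (N \<epsilon>)" unfolding N_def by linarith
    then have "C / \<epsilon> \<le> 2 ^ N \<epsilon>"
      using \<open>0 < C\<close> \<open>0 < \<epsilon>\<close> by (simp add: log_le_iff powr_realpow)
    then have "C \<le> \<epsilon> * 2 ^ N \<epsilon>" using \<open>0 < \<epsilon>\<close> by (simp add: field_simps)
    then have "G\<^sup>2 * R \<le> \<epsilon> * 2 ^ N \<epsilon>" using \<open>1 \<le> R\<close> by (simp add: C_def algebra_simps)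
    from exec_bisect_loop[OF inv _ this \<open>0 < \<epsilon>\<close>] \<open>1 \<le> R\<close> obtain k t where
      "exec (dual_projection P) (While bisect_guard bisect_step) s k t" "k \<le> N \<epsilon>"
      "approx_solution P x\<^sub>0 \<epsilon> (output_of t)" by auto
    with exec.Seq[OF init this(1)]
    show "\<exists>k s. exec (dual_projection P) bisect_program (input_state x\<^sub>0 \<epsilon> G R) k s \<and>
        k \<le> N \<epsilon> \<and> approx_solution P x\<^sub>0 \<epsilon> (output_of s)"
      unfolding bisect_program_def add_0 by blast
  qed
qed

end
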